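(* Let $a>0$, let $f\in C^2([a,\infty))$ be real-valued with $f(x)>0$ for all $x\in(a,\infty)$ and $|f|^{1/2}\notin L^1(a,\infty)$, and let $g:(a,\infty)\to\mathbb{C}$ be continuous. Assume that $\psi_{f,g}\in L^1(a,\infty)$. Then there exist two solutions $u_1$ and $u_2$ of $$u''(x)=(f(x)+g(x))\,u(x),\qquad x\in(a,\infty),$$ such that, setting $v_j(x):=|f(x)|^{1/4}u_j(x)$ for $j=1,2$, as $x\to\infty$, $$e^{-\int_a^x|f(r)|^{1/2}\,dr}\,v_1(x)\to 1,\qquad |f(x)|^{-1/2}e^{-\int_a^x|f(r)|^{1/2}\,dr}\,v_1'(x)\to 1,$$ $$e^{\int_a^x|f(r)|^{1/2}\,dr}\,v_2(x)\to 1,\qquad |f(x)|^{-1/2}e^{\int_a^x|f(r)|^{1/2}\,dr}\,v_2'(x)\to -1.$$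
   Context: The function $\psi_{f,g}$ is defined by $$\psi_{f,g}(x):=|f(x)|^{-1/4}\left(-\frac{d^2}{dx^2}\bigl(|f|^{-1/4}\bigr)(x)+g(x)\,|f(x)|^{-1/4}\right).$$ A solution is a twice continuously differentiable complex-valued function on $(a,\infty)$ satisfying the equation pointwise. $L^1(I)$ denotes the absolutely integrable functions on the interval $I$. *)

theory Defs
  imports "HOL-Analysis.Analysis"
begin

text \<open>
  At a boundary point of the set the derivatives are one-sided, so that \<open>C2_on {a..} f\<close> is
  membership of \<open>f\<close> in \<open>C\<^sup>2([a,\<infinity>))\<close>.
\<close>

definition C2_derivatives_on ::
    "real set \<Rightarrow> (real \<Rightarrow> 'a::real_normed_vector) \<Rightarrow> (real \<Rightarrow> 'a) \<Rightarrow> (real \<Rightarrow> 'a) \<Rightarrow> bool" where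
  "C2_derivatives_on I f f' f'' \<longleftrightarrow>
     (\<forall>x\<in>I. (f has_vector_derivative f' x) (at x within I)) \<and>
     (\<forall>x\<in>I. (f' has_vector_derivative f'' x) (at x within I)) \<and>
     continuous_on I f''"

definition C2_on :: "real set \<Rightarrow> (real \<Rightarrow> 'a::real_normed_vector) \<Rightarrow> bool" where
  "C2_on I f \<longleftrightarrow> (\<exists>f' f''. C2_derivatives_on I f f' f'')"

definition psi :: "(real \<Rightarrow> real) \<Rightarrow> (real \<Rightarrow> complex) \<Rightarrow> real \<Rightarrow> complex" where
  "psi f g x =
     complex_of_real (\<bar>f x\<bar> powr (-1/4)) *
     (- complex_of_real (deriv (deriv (\<lambda>t. \<bar>f t\<bar> powr (-1/4))) x)
      + g x * complex_of_real (\<bar>f x\<bar> powr (-1/4)))"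

definition is_solution_on ::
    "real set \<Rightarrow> (real \<Rightarrow> complex) \<Rightarrow> (real \<Rightarrow> complex) \<Rightarrow> bool" where
  "is_solution_on I q u \<longleftrightarrow>
     (\<exists>u' u''. C2_derivatives_on I u u' u'' \<and> (\<forall>x\<in>I. u'' x = q x * u x))"

end

theory Submission
  imports Defs
begin

text \<open>
  Put \<open>w = f\<^bsup>-1/4\<^esup>\<close>, \<open>v = u / w\<close> and \<open>p = w u' - w' u\<close>. Then \<open>u'' = (f + g) u\<close> becomes
  \<open>v' = w\<^bsup>-2\<^esup> p\<close>, \<open>p' = (w\<^bsup>-2\<^esup> + \<psi>) v\<close>, so that with \<open>S' = w\<^bsup>-2\<^esup>\<close>
  the functions \<open>A, B = e\<^bsup>-S\<^esup> (v \<plusminus> p) / 2\<close> satisfy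
  \<open>A' = \<psi> (A + B) / 2\<close> and \<open>B' = - 2 S' B - \<psi> (A + B) / 2\<close>. Starting from \<open>A = 1\<close>, \<open>B = 0\<close> at a
  point beyond which the integral of \<open>\<bar>\<psi>\<bar>\<close> is small, \<open>A\<close> tends to a nonzero limit and \<open>B\<close> to \<open>0\<close>;
  this gives the dominant solution \<open>u\<close>. For the recessive one take a solution \<open>z\<close> whose
  Wronskian with \<open>u\<close> is \<open>-2\<close>. The derivative of \<open>z / u\<close> is asymptotic to that of \<open>e\<^bsup>-2S\<^esup>\<close>, so by
  l'Hopital's rule \<open>z / u - L\<close> is asymptotic to \<open>e\<^bsup>-2S\<^esup>\<close> for some constant \<open>L\<close>, and
  \<open>z - L u\<close> is the required solution.
\<close>

subsection \<open>Growth estimates and limits at infinity\<close>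

text \<open>Mean value inequality with a scalar majorant. It replaces estimates of the norm of an
  integral by the integral of the norm, so that later bounds only need antiderivatives.\<close>

lemma norm_diff_le_if_vector_derivative_bounded:
  fixes F :: "real \<Rightarrow> 'a::real_normed_vector"
  assumes "x \<le> y"
    and F: "\<And>t. x \<le> t \<Longrightarrow> t \<le> y \<Longrightarrow> (F has_vector_derivative F' t) (at t)"
    and \<phi>: "\<And>t. x \<le> t \<Longrightarrow> t \<le> y \<Longrightarrow> (\<phi> has_real_derivative \<phi>' t) (at t)"
    and bound: "\<And>t. x \<le> t \<Longrightarrow> t \<le> y \<Longrightarrow> norm (F' t) \<le> \<phi>' t"
  shows "norm (F y - F x) \<le> \<phi> y - \<phi> x"
proof (cases "x = y")
  case False
  show ?thesis
  proof (rule differentiable_bound_general)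
    show "continuous_on {x..y} F"
      by (intro continuous_at_imp_continuous_on ballI has_vector_derivative_continuous[OF F]) auto
    show "continuous_on {x..y} \<phi>"
      by (intro continuous_at_imp_continuous_on ballI DERIV_isCont[OF \<phi>]) auto
    show "norm (F' t) \<le> \<phi>' t" "(F has_vector_derivative F' t) (at t)"
      "(\<phi> has_vector_derivative \<phi>' t) (at t)" if "x < t" "t < y" for t
      using F \<phi> bound that by (auto simp: has_real_derivative_iff_has_vector_derivative)
  qed (use assms(1) False in auto)
qed simp

text \<open>The substitution \<open>t = b + \<tau> * (x - b)\<close> moves the estimate to the unit
  interval and so treats \<open>x < b\<close> and \<open>x > b\<close> alike. Iterating the bound
  produces the factorials in the Picard series.\<close>

lemma norm_le_if_vector_derivative_power_bounded:
  fixes F :: "real \<Rightarrow> 'a::real_normed_vector"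
  assumes F: "\<And>t. t \<in> closed_segment b x \<Longrightarrow> (F has_vector_derivative F' t) (at t)"
    and "F b = 0"
    and bound: "\<And>t. t \<in> closed_segment b x \<Longrightarrow> norm (F' t) \<le> C * \<bar>t - b\<bar> ^ n"
  shows "norm (F x) \<le> C * \<bar>x - b\<bar> ^ Suc n / Suc n"
proof -
  define \<gamma> where "\<gamma> = (\<lambda>\<tau>. b + \<tau> * (x - b))"
  have \<gamma>: "\<gamma> \<tau> \<in> closed_segment b x" if "0 \<le> \<tau>" "\<tau> \<le> 1" for \<tau>
    using that unfolding \<gamma>_def closed_segment_real_eq by (auto simp: mult.commute)
  have "norm ((F \<circ> \<gamma>) 1 - (F \<circ> \<gamma>) 0)
      \<le> C * \<bar>x - b\<bar> ^ Suc n * 1 ^ Suc n / Suc n - C * \<bar>x - b\<bar> ^ Suc n * 0 ^ Suc n / Suc n"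
  proof (rule norm_diff_le_if_vector_derivative_bounded)
    fix \<tau> :: real assume \<tau>: "0 \<le> \<tau>" "\<tau> \<le> 1"
    have "(\<gamma> has_vector_derivative (x - b)) (at \<tau>)"
      unfolding \<gamma>_def by (auto intro!: derivative_eq_intros)
    then show "((F \<circ> \<gamma>) has_vector_derivative (x - b) *\<^sub>R F' (\<gamma> \<tau>)) (at \<tau>)"
      by (rule vector_diff_chain_at) (rule F[OF \<gamma>[OF \<tau>]])
    show "((\<lambda>\<tau>. C * \<bar>x - b\<bar> ^ Suc n * \<tau> ^ Suc n / Suc n) has_real_derivative
        C * \<bar>x - b\<bar> ^ Suc n * \<tau> ^ n) (at \<tau>)"
      by (auto intro!: derivative_eq_intros simp: field_simps simp del: power_Suc of_nat_Suc)
    have "\<bar>\<gamma> \<tau> - b\<bar> = \<tau> * \<bar>x - b\<bar>"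
      using \<tau> by (simp add: \<gamma>_def abs_mult)
    then have "norm (F' (\<gamma> \<tau>)) \<le> C * (\<tau> * \<bar>x - b\<bar>) ^ n"
      using bound[OF \<gamma>[OF \<tau>]] by simp
    then have "\<bar>x - b\<bar> * norm (F' (\<gamma> \<tau>)) \<le> \<bar>x - b\<bar> * (C * (\<tau> * \<bar>x - b\<bar>) ^ n)"
      by (rule mult_left_mono) simp
    then show "norm ((x - b) *\<^sub>R F' (\<gamma> \<tau>)) \<le> C * \<bar>x - b\<bar> ^ Suc n * \<tau> ^ n"
      by (simp add: power_mult_distrib mult_ac)
  qed simp
  then show ?thesis
    using \<open>F b = 0\<close> by (simp add: \<gamma>_def)
qed

text \<open>Cauchy criterion at infinity: the oscillation of \<open>F\<close> beyond
  \<open>x\<close> is controlled by \<open>\<theta> x\<close>, so the values at the integers form a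
  Cauchy sequence, and the same control carries their limit over to real arguments.\<close>

lemma tendsto_at_top_if_norm_diff_le:
  fixes F :: "real \<Rightarrow> 'a::banach"
  assumes "\<And>x y. c \<le> x \<Longrightarrow> x \<le> y \<Longrightarrow> norm (F y - F x) \<le> \<theta> x"
    and "(\<theta> \<longlongrightarrow> 0) at_top"
  shows "\<exists>L. (F \<longlongrightarrow> L) at_top"
proof -
  have *: "\<exists>X. \<forall>x\<ge>X. \<forall>y\<ge>x. norm (F y - F x) < e" if "e > 0" for e
  proof -
    have "eventually (\<lambda>x. \<theta> x < e) at_top"
      using assms(2) that by (rule order_tendstoD)
    then obtain X where "\<forall>x\<ge>X. \<theta> x < e"
      by (auto simp: eventually_at_top_linorder)
    then show ?thesis
      using assms(1) by (intro exI[of _ "max X c"]) (fastforce intro: le_less_trans)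
  qed
  have "Cauchy (\<lambda>n. F (real n))"
  proof (rule CauchyI')
    fix e :: real assume "e > 0"
    then obtain X where X: "\<forall>x\<ge>X. \<forall>y\<ge>x. norm (F y - F x) < e"
      using * by blast
    obtain N where "X \<le> real N"
      using real_arch_simple by blast
    with X have "dist (F (real m)) (F (real n)) < e" if "m \<ge> N" "n > m" for m n
      using that by (simp add: dist_norm norm_minus_commute[of "F (real m)"])
    then show "\<exists>M. \<forall>m\<ge>M. \<forall>n>m. dist (F (real m)) (F (real n)) < e"
      by blast
  qed
  then obtain L where L: "(\<lambda>n. F (real n)) \<longlonglongrightarrow> L"
    using Cauchy_convergent_iff convergent_def by blast
  have "(F \<longlongrightarrow> L) at_top"
  proof (rule tendstoI)
    fix e :: real assume "e > 0"
    then obtain X where X: "\<forall>x\<ge>X. \<forall>y\<ge>x. norm (F y - F x) < e / 2"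
      using *[of "e / 2"] by auto
    have "dist (F x) L < e" if "X \<le> x" for x
    proof -
      have "(\<lambda>n. norm (F (real n) - F x)) \<longlonglongrightarrow> norm (L - F x)"
        by (intro tendsto_intros L)
      moreover have "\<forall>\<^sub>F n in sequentially. norm (F (real n) - F x) \<le> e / 2"
        using eventually_ge_at_top[of "nat \<lceil>x\<rceil>"]
        by eventually_elim (use X that in \<open>auto intro!: less_imp_le\<close>)
      ultimately have "norm (L - F x) \<le> e / 2"
        by (rule tendsto_upperbound) simp
      with \<open>e > 0\<close> show ?thesis
        by (simp add: dist_norm norm_minus_commute)
    qed
    then show "\<forall>\<^sub>F x in at_top. dist (F x) L < e"
      using eventually_at_top_linorder by blast
  qed
  then show ?thesis ..
qed

lemma tendsto_at_top_if_increasing_bounded: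
  fixes F :: "real \<Rightarrow> real"
  assumes mono: "\<And>x y. c \<le> x \<Longrightarrow> x \<le> y \<Longrightarrow> F x \<le> F y"
    and bound: "\<And>x. c \<le> x \<Longrightarrow> F x \<le> M"
  shows "\<exists>L. (F \<longlongrightarrow> L) at_top \<and> (\<forall>x\<ge>c. F x \<le> L)"
proof -
  define L where "L = Sup (F ` {c..})"
  have bdd: "bdd_above (F ` {c..})"
    by (rule bdd_aboveI2[of _ _ M]) (use bound in simp)
  have le: "F x \<le> L" if "c \<le> x" for x
    unfolding L_def by (rule cSup_upper[OF _ bdd]) (use that in simp)
  have "(F \<longlongrightarrow> L) at_top"
  proof (rule increasing_tendsto)
    show "\<forall>\<^sub>F x in at_top. F x \<le> L"
      using eventually_ge_at_top[of c] by (rule eventually_mono) (rule le)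
    fix l assume "l < L"
    moreover have "F ` {c..} \<noteq> {}" by simp
    ultimately obtain x where x: "c \<le> x" "l < F x"
      unfolding L_def using less_cSup_iff[OF _ bdd] by blast
    show "\<forall>\<^sub>F y in at_top. l < F y"
      using eventually_ge_at_top[of x]
      by (rule eventually_mono) (rule less_le_trans[OF x(2) mono[OF x(1)]])
  qed
  with le show ?thesis by blast
qed

text \<open>The usual proof by Cauchy's mean value theorem fails for vector values. Instead,
  \<open>G = F - \<theta> \<rho>\<close> has derivative \<open>\<theta>' (r - \<rho>)\<close>, which
  is eventually at most \<open>- e * \<theta>'\<close> in norm. Hence \<open>G\<close> varies by at
  most \<open>e * \<theta> x\<close> beyond \<open>x\<close>, it has a limit \<open>L\<close>, and
  dividing the distance of \<open>G x\<close> from \<open>L\<close> by \<open>\<theta> x\<close>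
  gives the claim.\<close>

lemma lhopital_at_top_vector:
  fixes F :: "real \<Rightarrow> 'a::banach"
  assumes F: "\<And>x. c \<le> x \<Longrightarrow> (F has_vector_derivative \<theta>' x *\<^sub>R r x) (at x)"
    and \<theta>: "\<And>x. c \<le> x \<Longrightarrow> (\<theta> has_real_derivative \<theta>' x) (at x)"
    and neg: "\<And>x. c \<le> x \<Longrightarrow> \<theta>' x \<le> 0"
    and pos: "\<And>x. c \<le> x \<Longrightarrow> \<theta> x > 0"
    and \<theta>0: "(\<theta> \<longlongrightarrow> 0) at_top"
    and r: "(r \<longlongrightarrow> \<rho>) at_top"
  shows "\<exists>L. ((\<lambda>x. (F x - L) /\<^sub>R \<theta> x) \<longlongrightarrow> \<rho>) at_top"
proof -
  define G where "G = (\<lambda>x. F x - \<theta> x *\<^sub>R \<rho>)"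
  have G: "\<exists>X\<ge>c. \<forall>x\<ge>X. \<forall>y\<ge>x. norm (G y - G x) \<le> e * \<theta> x" if "e > 0" for e
  proof -
    have "\<forall>\<^sub>F x in at_top. norm (r x - \<rho>) < e"
      using tendstoD[OF r that] by (simp add: dist_norm)
    then obtain X where X: "\<forall>x\<ge>X. norm (r x - \<rho>) < e"
      by (auto simp: eventually_at_top_linorder)
    have "norm (G y - G x) \<le> e * \<theta> x" if "max X c \<le> x" "x \<le> y" for x y
    proof -
      have "norm (G y - G x) \<le> - e * \<theta> y - (- e * \<theta> x)"
      proof (rule norm_diff_le_if_vector_derivative_bounded[OF \<open>x \<le> y\<close>])
        fix t assume "x \<le> t" "t \<le> y"
        with that have t: "c \<le> t" "X \<le> t" by auto
        show "(G has_vector_derivative \<theta>' t *\<^sub>R (r t - \<rho>)) (at t)"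
          unfolding G_def using F[OF t(1)] \<theta>[OF t(1)]
          by (auto intro!: derivative_eq_intros simp: scaleR_diff_right)
        show "((\<lambda>t. - e * \<theta> t) has_real_derivative - e * \<theta>' t) (at t)"
          by (intro DERIV_cmult \<theta> t)
        show "norm (\<theta>' t *\<^sub>R (r t - \<rho>)) \<le> - e * \<theta>' t"
          using mult_left_mono[of "norm (r t - \<rho>)" e "- \<theta>' t"] neg[OF t(1)] X t
          by (auto simp: mult.commute less_imp_le)
      qed
      moreover have "e * \<theta> y > 0"
        using \<open>e > 0\<close> pos[of y] that by auto
      ultimately show ?thesis by simp
    qed
    then show ?thesis
      by (intro exI[of _ "max X c"]) auto
  qed
  \<comment> \<open>Any fixed \<open>e\<close> yields the existence of \<open>L\<close>; arbitrarily
    small \<open>e\<close> is needed only for the rate afterwards.\<close>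
  from G[of 1] obtain X where X: "\<forall>x\<ge>X. \<forall>y\<ge>x. norm (G y - G x) \<le> \<theta> x"
    by auto
  obtain L where L: "(G \<longlongrightarrow> L) at_top"
    using tendsto_at_top_if_norm_diff_le[of X G \<theta>] X \<theta>0 by blast
  have "((\<lambda>x. (F x - L) /\<^sub>R \<theta> x) \<longlongrightarrow> \<rho>) at_top"
  proof (rule tendstoI)
    fix e :: real assume "e > 0"
    then obtain X where X: "X \<ge> c" "\<forall>x\<ge>X. \<forall>y\<ge>x. norm (G y - G x) \<le> e / 2 * \<theta> x"
      using G[of "e / 2"] by auto
    have "dist ((F x - L) /\<^sub>R \<theta> x) \<rho> < e" if "X \<le> x" for x
    proof -
      have "\<theta> x > 0" using pos that X(1) by simp
      have "((\<lambda>y. norm (G y - G x)) \<longlongrightarrow> norm (L - G x)) at_top"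
        by (intro tendsto_intros L)
      moreover have "\<forall>\<^sub>F y in at_top. norm (G y - G x) \<le> e / 2 * \<theta> x"
        using eventually_ge_at_top[of x] by eventually_elim (use X(2) that in auto)
      ultimately have "norm (L - G x) \<le> e / 2 * \<theta> x"
        by (rule tendsto_upperbound) simp
      moreover have "(F x - L) /\<^sub>R \<theta> x - \<rho> = (G x - L) /\<^sub>R \<theta> x"
        using \<open>\<theta> x > 0\<close> by (simp add: G_def algebra_simps)
      then have "dist ((F x - L) /\<^sub>R \<theta> x) \<rho> = norm (L - G x) / \<theta> x"
        using \<open>\<theta> x > 0\<close> norm_minus_commute[of L "G x"] by (simp add: dist_norm divide_inverse_commute)
      ultimately have "dist ((F x - L) /\<^sub>R \<theta> x) \<rho> \<le> e / 2"
        using \<open>\<theta> x > 0\<close> by (simp add: pos_divide_le_eq)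
      with \<open>e > 0\<close> show ?thesis by simp
    qed
    then show "\<forall>\<^sub>F x in at_top. dist ((F x - L) /\<^sub>R \<theta> x) \<rho> < e"
      using eventually_at_top_linorder by blast
  qed
  then show ?thesis ..
qed

text \<open>The integral is monotone in its upper end. If it were bounded it would converge, which
  for a nonnegative integrand means absolute integrability on the half line.\<close>

lemma filterlim_integral_at_top_if_not_absolutely_integrable:
  fixes h :: "real \<Rightarrow> real"
  assumes cont: "continuous_on {a..} h" and nonneg: "\<And>x. a \<le> x \<Longrightarrow> 0 \<le> h x"
    and not_int: "\<not> h absolutely_integrable_on {a<..}"
  shows "filterlim (\<lambda>x. integral {a..x} h) at_top at_top"
proof -
  have int: "h integrable_on {a..x}" for x
    by (intro integrable_continuous_real continuous_on_subset[OF cont]) auto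
  have mono: "integral {a..x} h \<le> integral {a..y} h" if "x \<le> y" for x y
    using that nonneg by (intro integral_subset_le int) auto
  have unbounded: "\<exists>x\<ge>a. Z < integral {a..x} h" for Z
  proof (rule ccontr)
    assume "\<not> (\<exists>x\<ge>a. Z < integral {a..x} h)"
    then obtain l where "((\<lambda>x. integral {a..x} h) \<longlongrightarrow> l) at_top"
      using tendsto_at_top_if_increasing_bounded[of a "\<lambda>x. integral {a..x} h" Z] mono
      by (auto simp: not_less)
    then have "(h has_integral l) {a..}"
      using int nonneg by (intro has_integral_to_inf) auto
    then have "h absolutely_integrable_on {a..}"
      using nonneg by (intro nonnegative_absolutely_integrable_1) auto
    then show False
      using not_int by (auto dest: set_integrable_subset[where B = "{a<..}"])
  qed
  show ?thesis
    unfolding filterlim_at_top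
  proof
    fix Z
    obtain x where x: "Z < integral {a..x} h"
      using unbounded by blast
    show "\<forall>\<^sub>F y in at_top. Z \<le> integral {a..y} h"
      using eventually_ge_at_top[of x]
      by eventually_elim (use mono x in \<open>fastforce intro: order_trans\<close>)
  qed
qed

subsection \<open>Linear equations of second order\<close>

text \<open>The M-test makes the differentiated series converge uniformly, which is what
  \<open>has_derivative_series\<close> requires. Openness of the interval turns derivatives within
  it into ordinary ones.\<close>

lemma has_vector_derivative_suminf:
  fixes f :: "nat \<Rightarrow> real \<Rightarrow> 'a::banach"
  assumes f: "\<And>n x. x \<in> {l<..<r} \<Longrightarrow> (f n has_vector_derivative f' n x) (at x)"
    and bound: "\<And>n x. x \<in> {l<..<r} \<Longrightarrow> norm (f' n x) \<le> M n" and "summable M"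
    and summable: "\<And>x. x \<in> {l<..<r} \<Longrightarrow> summable (\<lambda>n. f n x)"
    and x: "x \<in> {l<..<r}"
  shows "((\<lambda>x. \<Sum>n. f n x) has_vector_derivative (\<Sum>n. f' n x)) (at x)"
proof -
  have lim: "uniform_limit {l<..<r} (\<lambda>n x. \<Sum>i<n. f' i x) (\<lambda>x. \<Sum>i. f' i x) sequentially"
    using bound \<open>summable M\<close> by (rule Weierstrass_m_test)
  have "\<exists>g. \<forall>x\<in>{l<..<r}. (\<lambda>n. f n x) sums g x \<and>
      (g has_derivative (\<lambda>h. h *\<^sub>R (\<Sum>n. f' n x))) (at x within {l<..<r})"
  proof (rule has_derivative_series)
    show "(f n has_derivative (\<lambda>h. h *\<^sub>R f' n x)) (at x within {l<..<r})"
      if "x \<in> {l<..<r}" for n x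
      using f[OF that, of n] by (auto simp: has_vector_derivative_def intro: has_derivative_at_withinI)
    show "(\<lambda>n. f n x) sums (\<Sum>n. f n x)"
      using summable[OF x] by (rule summable_sums)
    fix e :: real assume "e > 0"
    with lim have "\<forall>\<^sub>F n in sequentially. \<forall>x\<in>{l<..<r}. norm ((\<Sum>i<n. f' i x) - (\<Sum>i. f' i x)) < e"
      by (auto simp: uniform_limit_iff dist_norm)
    then show "\<forall>\<^sub>F n in sequentially. \<forall>x\<in>{l<..<r}. \<forall>h.
        norm ((\<Sum>i<n. h *\<^sub>R f' i x) - h *\<^sub>R (\<Sum>i. f' i x)) \<le> e * norm h"
    proof eventually_elim
      case (elim n)
      show ?case
      proof (intro ballI allI)
        fix x h :: real assume "x \<in> {l<..<r}"
        with elim have "\<bar>h\<bar> * norm ((\<Sum>i<n. f' i x) - (\<Sum>i. f' i x)) \<le> \<bar>h\<bar> * e"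
          by (intro mult_left_mono) (auto intro: less_imp_le)
        then show "norm ((\<Sum>i<n. h *\<^sub>R f' i x) - h *\<^sub>R (\<Sum>i. f' i x)) \<le> e * norm h"
          by (simp add: mult.commute flip: scaleR_sum_right scaleR_diff_right)
      qed
    qed
  qed (use x in auto)
  then obtain g where g: "\<And>x. x \<in> {l<..<r} \<Longrightarrow> (\<lambda>n. f n x) sums g x"
      "\<And>x. x \<in> {l<..<r} \<Longrightarrow> (g has_vector_derivative (\<Sum>n. f' n x)) (at x within {l<..<r})"
    unfolding has_vector_derivative_def by blast
  have "(g has_vector_derivative (\<Sum>n. f' n x)) (at x)"
    using g(2)[OF x] x has_vector_derivative_within_open[of x "{l<..<r}"] by auto
  then show ?thesis
    by (rule has_vector_derivative_transform_within_open[OF _ open_greaterThanLessThan x])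
       (use g(1) in \<open>auto simp: sums_iff\<close>)
qed

text \<open>An antiderivative on the whole half line, rather than on compact pieces, makes every
  Picard term a global function.\<close>

lemma antiderivative_vanishing_at:
  fixes h :: "real \<Rightarrow> 'a::euclidean_space"
  assumes "continuous_on {a<..} h"
  shows "\<exists>F. F b = 0 \<and> (\<forall>x>a. (F has_vector_derivative h x) (at x))"
proof -
  have "isCont h x" if "a < x" for x
    using assms that by (simp add: continuous_on_eq_continuous_at open_greaterThan)
  then obtain F where F: "\<forall>x>a. (F has_vector_derivative h x) (at x)"
    using einterval_antiderivative[of "ereal a" \<infinity> h] by auto
  then show ?thesis
    by (intro exI[of _ "\<lambda>x. F x - F b"]) (auto intro!: derivative_eq_intros)
qed

text \<open>Picard iteration for the system \<open>u' = w\<close>, \<open>w' = q u\<close>. All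
  terms of the series live on the whole half line and only the convergence is checked locally, so no
  local solutions have to be glued.\<close>

lemma linear_second_order_initial_value_problem:
  fixes q :: "real \<Rightarrow> complex"
  assumes q: "continuous_on {a<..} q" and "a < b"
  obtains u u' where "u b = c\<^sub>0" "u' b = c\<^sub>1"
    "\<And>x. a < x \<Longrightarrow> (u has_vector_derivative u' x) (at x)"
    "\<And>x. a < x \<Longrightarrow> (u' has_vector_derivative q x * u x) (at x)"
proof -
  define J :: "(real \<Rightarrow> complex) \<Rightarrow> real \<Rightarrow> complex" where
    "J h = (SOME F. F b = 0 \<and> (\<forall>x>a. (F has_vector_derivative h x) (at x)))" for h
  have J: "J h b = 0" "\<And>x. a < x \<Longrightarrow> (J h has_vector_derivative h x) (at x)"
    if "continuous_on {a<..} h" for h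
    using someI_ex[OF antiderivative_vanishing_at[OF that, of b]] by (auto simp: J_def)
  \<comment> \<open>By linearity it suffices to iterate on the corrections: \<open>Y n\<close> is
    the \<open>n\<close>-th term of the Picard series, not the \<open>n\<close>-th
    approximation.\<close>
  define Y where "Y = rec_nat (\<lambda>_. c\<^sub>0, \<lambda>_. c\<^sub>1) (\<lambda>_ (u, w). (J w, J (\<lambda>x. q x * u x)))"
  define u where "u = (\<lambda>n. fst (Y n))"
  define w where "w = (\<lambda>n. snd (Y n))"
  have u0: "u 0 = (\<lambda>_. c\<^sub>0)" and w0: "w 0 = (\<lambda>_. c\<^sub>1)"
    and uSuc: "u (Suc n) = J (w n)" and wSuc: "w (Suc n) = J (\<lambda>x. q x * u n x)" for n
    by (auto simp: u_def w_def Y_def split: prod.split)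
  have cont: "continuous_on {a<..} (u n) \<and> continuous_on {a<..} (w n)" for n
  proof (induction n)
    case (Suc n)
    then have "continuous_on {a<..} (\<lambda>x. q x * u n x)"
      by (auto intro!: continuous_intros q)
    with Suc show ?case
      unfolding uSuc wSuc using J(2)
      by (blast intro: has_vector_derivative_continuous continuous_at_imp_continuous_on
          dest: greaterThan_iff[THEN iffD1])
  qed (auto simp: u0 w0)
  then have cont_qu: "continuous_on {a<..} (\<lambda>x. q x * u n x)" for n
    by (auto intro!: continuous_intros q)
  \<comment> \<open>Termwise derivatives. The terms of index 0 are constants, so the differentiated
    series are the original ones shifted by one place behind a zero.\<close>
  define u' where "u' = (\<lambda>n. case n of 0 \<Rightarrow> \<lambda>_. 0 | Suc m \<Rightarrow> w m)"
  define w' where "w' = (\<lambda>n x. case n of 0 \<Rightarrow> 0 | Suc m \<Rightarrow> q x * u m x)"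
  have u': "(u n has_vector_derivative u' n x) (at x)" if "a < x" for n x
    using J(2)[of "w (n - 1)"] cont that by (cases n) (auto simp: u'_def u0 uSuc)
  have w': "(w n has_vector_derivative w' n x) (at x)" if "a < x" for n x
    using J(2)[OF cont_qu, of x "n - 1"] that by (cases n) (auto simp: w'_def w0 wSuc)
  have b0: "u (Suc n) b = 0" "w (Suc n) b = 0" for n
    using J(1) cont cont_qu by (auto simp: uSuc wSuc)

  \<comment> \<open>Locally uniform convergence of the Picard series\<close>
  have local: "summable (\<lambda>n. u n x) \<and> summable (\<lambda>n. w n x) \<and>
      ((\<lambda>x. \<Sum>n. u n x) has_vector_derivative (\<Sum>n. u' n x)) (at x) \<and>
      ((\<lambda>x. \<Sum>n. w n x) has_vector_derivative (\<Sum>n. w' n x)) (at x)" if "a < x" for x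
  proof -
    \<comment> \<open>The compact interval has to contain \<open>b\<close> as well as a
      neighbourhood of \<open>x\<close>, because the estimates integrate from
      \<open>b\<close>.\<close>
    define l r where "l = (a + min b x) / 2" and "r = max b x + 1"
    have lr: "a < l" "l < b" "l < x" "b < r" "x < r"
      using \<open>a < b\<close> \<open>a < x\<close> by (auto simp: l_def r_def)
    have "compact (q ` {l..r})"
      using lr by (intro compact_continuous_image continuous_on_subset[OF q]) auto
    then obtain M0 where M0: "\<forall>t\<in>{l..r}. norm (q t) \<le> M0"
      by (auto dest!: compact_imp_bounded simp: bounded_iff)
    \<comment> \<open>With \<open>M \<ge> 1\<close> one bound serves both recurrences: passing from
      \<open>w\<close> to the next \<open>u\<close> involves no factor \<open>q\<close>, passing
      from \<open>u\<close> to the next \<open>w\<close> does.\<close>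
    define M where "M = max 1 M0"
    have M: "M \<ge> 1" "\<And>t. t \<in> {l..r} \<Longrightarrow> norm (q t) \<le> M"
      using M0 by (fastforce simp: M_def)+
    define K where "K = norm c\<^sub>0 + norm c\<^sub>1"
    have K: "norm (u n t) \<le> K * M ^ n / fact n * \<bar>t - b\<bar> ^ n \<and>
        norm (w n t) \<le> K * M ^ n / fact n * \<bar>t - b\<bar> ^ n" if "t \<in> {l..r}" for n t
      using that
    proof (induction n arbitrary: t)
      case (Suc n)
      have seg: "\<tau> \<in> {l..r}" "a < \<tau>" if "\<tau> \<in> closed_segment b t" for \<tau>
        using that lr Suc.prems by (auto simp: closed_segment_eq_real_ivl split: if_splits)
      have K0: "K * M ^ n / fact n * \<bar>\<tau> - b\<bar> ^ n \<ge> 0" for \<tau>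
        using M(1) by (auto simp: K_def)
      have "K * M ^ n / fact n * \<bar>\<tau> - b\<bar> ^ n \<le> M * (K * M ^ n / fact n * \<bar>\<tau> - b\<bar> ^ n)" for \<tau>
        using mult_right_mono[OF M(1) K0] by simp
      then have "norm (w n \<tau>) \<le> K * M ^ Suc n / fact n * \<bar>\<tau> - b\<bar> ^ n"
        if "\<tau> \<in> closed_segment b t" for \<tau>
        using Suc.IH[OF seg(1)[OF that]] by (fastforce intro: order_trans simp: mult_ac)
      then have "norm (u (Suc n) t) \<le> K * M ^ Suc n / fact n * \<bar>t - b\<bar> ^ Suc n / Suc n"
        using seg(2) by (intro norm_le_if_vector_derivative_power_bounded[where F'="u' (Suc n)"] u' b0)
          (auto simp: u'_def)
      moreover have "norm (q \<tau> * u n \<tau>) \<le> K * M ^ Suc n / fact n * \<bar>\<tau> - b\<bar> ^ n"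
        if "\<tau> \<in> closed_segment b t" for \<tau>
        using mult_mono[OF M(2)[OF seg(1)[OF that]] conjunct1[OF Suc.IH[OF seg(1)[OF that]]]] M(1)
        by (simp add: norm_mult mult_ac)
      then have "norm (w (Suc n) t) \<le> K * M ^ Suc n / fact n * \<bar>t - b\<bar> ^ Suc n / Suc n"
        using seg(2) by (intro norm_le_if_vector_derivative_power_bounded[where F'="w' (Suc n)"] w' b0)
          (auto simp: w'_def)
      ultimately show ?case
        by (simp add: mult_ac)
    qed (auto simp: u0 w0 K_def)
    define B where "B = (\<lambda>n. K * ((M * (r - l)) ^ n / fact n))"
    have "summable B"
      unfolding B_def using summable_exp[of "M * (r - l)"]
      by (intro summable_mult) (simp add: divide_inverse mult.commute)
    have B: "norm (u n t) \<le> B n" "norm (w n t) \<le> B n" if "t \<in> {l<..<r}" for n t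
    proof -
      have "\<bar>t - b\<bar> ^ n \<le> (r - l) ^ n"
        using that lr by (intro power_mono) auto
      then have "K * M ^ n / fact n * \<bar>t - b\<bar> ^ n \<le> K * M ^ n / fact n * (r - l) ^ n"
        using M(1) by (intro mult_left_mono) (auto simp: K_def)
      also have "\<dots> = B n"
        by (simp add: B_def power_mult_distrib)
      finally show "norm (u n t) \<le> B n" "norm (w n t) \<le> B n"
        using K[of t n] that by auto
    qed
    have Bsum: "summable (\<lambda>n. u n t)" "summable (\<lambda>n. w n t)" if "t \<in> {l<..<r}" for t
      using B[OF that] \<open>summable B\<close> by (auto intro: summable_comparison_test')
    \<comment> \<open>Majorant for the shifted series of derivatives; the factor \<open>M\<close>
      pays for \<open>q\<close>.\<close>
    define B' where "B' = (\<lambda>n. case n of 0 \<Rightarrow> 0 | Suc m \<Rightarrow> M * B m)"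
    have "summable (\<lambda>n. B' (Suc n))"
      using \<open>summable B\<close> by (auto simp: B'_def intro: summable_mult)
    then have "summable B'"
      by (simp add: summable_Suc_iff)
    have "B n \<ge> 0" for n
      using B(1)[of b n] lr order_trans[OF norm_ge_zero] by auto
    then have "B n \<le> M * B n" for n
      using mult_right_mono[OF M(1)] by fastforce
    then have B': "norm (u' n t) \<le> B' n" "norm (w' n t) \<le> B' n" if "t \<in> {l<..<r}" for n t
      using B[OF that, of "n - 1"] M(1) mult_mono[OF M(2)[of t] B(1)[OF that, of "n - 1"]] that
      by (auto simp: u'_def w'_def B'_def norm_mult split: nat.split intro: order_trans)
    have "x \<in> {l<..<r}"
      using lr by simp
    moreover have "((\<lambda>x. \<Sum>n. u n x) has_vector_derivative (\<Sum>n. u' n x)) (at x)"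
      using \<open>x \<in> {l<..<r}\<close> lr Bsum \<open>summable B'\<close>
      by (intro has_vector_derivative_suminf[where M=B' and l=l and r=r] u' B') auto
    moreover have "((\<lambda>x. \<Sum>n. w n x) has_vector_derivative (\<Sum>n. w' n x)) (at x)"
      using \<open>x \<in> {l<..<r}\<close> lr Bsum \<open>summable B'\<close>
      by (intro has_vector_derivative_suminf[where M=B' and l=l and r=r] w' B') auto
    ultimately show ?thesis
      using Bsum by blast
  qed
  show ?thesis
  proof
    have "(\<Sum>n. u n b) = (\<Sum>n\<in>{0}. u n b)" "(\<Sum>n. w n b) = (\<Sum>n\<in>{0}. w n b)"
      using b0 by (intro suminf_finite; auto simp: gr0_conv_Suc)+
    then show "(\<Sum>n. u n b) = c\<^sub>0" "(\<Sum>n. w n b) = c\<^sub>1"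
      by (auto simp: u0 w0)
    fix x assume x: "a < x"
    have "(\<Sum>n. u' n x) = (\<Sum>n. w n x)"
      using suminf_split_head[of "\<lambda>n. u' n x"] local[OF x]
      by (simp add: u'_def summable_Suc_iff[of "\<lambda>n. u' n x", unfolded u'_def, simplified, symmetric])
    moreover have "(\<Sum>n. w' n x) = q x * (\<Sum>n. u n x)"
      using suminf_split_head[of "\<lambda>n. w' n x"] local[OF x]
      by (simp add: w'_def suminf_mult summable_mult
          summable_Suc_iff[of "\<lambda>n. w' n x", unfolded w'_def, simplified, symmetric])
    ultimately show "((\<lambda>x. \<Sum>n. u n x) has_vector_derivative (\<Sum>n. w n x)) (at x)"
      "((\<lambda>x. \<Sum>n. w n x) has_vector_derivative q x * (\<Sum>n. u n x)) (at x)"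
      using local[OF x] by auto
  qed
qed

lemma has_vector_derivative_divide_complex:
  fixes u v :: "real \<Rightarrow> complex"
  assumes "(u has_vector_derivative u') (at x)" "(v has_vector_derivative v') (at x)" "v x \<noteq> 0"
  shows "((\<lambda>x. u x / v x) has_vector_derivative (v x * u' - u x * v') / (v x)\<^sup>2) (at x)"
  using has_derivative_divide[OF assms(1,2)[unfolded has_vector_derivative_def] assms(3)]
  unfolding has_vector_derivative_def
  by (rule has_derivative_eq_rhs) (use assms(3) in \<open>auto simp: fun_eq_iff scaleR_conv_of_real field_simps power2_eq_square\<close>)

text \<open>The equation has no first-order term, so the derivative of the Wronskian reduces to
  \<open>u * (q * v) - v * (q * u)\<close>, which cancels.\<close>

lemma wronskian_constant:
  fixes q u v :: "real \<Rightarrow> complex"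
  assumes u: "\<And>x. a < x \<Longrightarrow> (u has_vector_derivative u' x) (at x)"
      "\<And>x. a < x \<Longrightarrow> (u' has_vector_derivative q x * u x) (at x)"
    and v: "\<And>x. a < x \<Longrightarrow> (v has_vector_derivative v' x) (at x)"
      "\<And>x. a < x \<Longrightarrow> (v' has_vector_derivative q x * v x) (at x)"
    and x: "a < x" and b: "a < b"
  shows "u x * v' x - v x * u' x = u b * v' b - v b * u' b"
proof -
  have "((\<lambda>x. u x * v' x - v x * u' x) has_derivative (\<lambda>h. 0)) (at x within {a<..})" if "x \<in> {a<..}" for x
  proof -
    have "((\<lambda>x. u x * v' x - v x * u' x) has_vector_derivative 0) (at x)"
      using that u v by (auto intro!: derivative_eq_intros)
    then show ?thesis
      by (auto simp: has_vector_derivative_def intro: has_derivative_at_withinI)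
  qed
  then obtain c where "\<forall>x\<in>{a<..}. u x * v' x - v x * u' x = c"
    using has_derivative_zero_constant[of "{a<..}"] by blast
  then show ?thesis using x b by simp
qed

subsection \<open>Liouville--Green asymptotics\<close>

text \<open>\<open>A\<close> is driven only by the integrable \<open>k\<close> and hence converges,
  while \<open>B\<close> is damped by a factor that tends to 0 with \<open>exp (- 2 S)\<close>. The
  bound 1/4 is small enough both to close an a priori estimate of \<open>A + B\<close> and to keep
  \<open>A\<close> within 1/2 of its initial value 1, which makes its limit nonzero.\<close>

lemma perturbed_diagonal_system_asymptotics:
  fixes A B k :: "real \<Rightarrow> complex" and s S \<Phi> :: "real \<Rightarrow> real"
  assumes A: "\<And>x. b \<le> x \<Longrightarrow> (A has_vector_derivative k x * (A x + B x)) (at x)"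
    and B: "\<And>x. b \<le> x \<Longrightarrow>
      (B has_vector_derivative - (2 * s x) *\<^sub>R B x - k x * (A x + B x)) (at x)"
    and init: "A b = 1" "B b = 0"
    and S: "\<And>x. b \<le> x \<Longrightarrow> (S has_real_derivative s x) (at x)"
    and s: "\<And>x. b \<le> x \<Longrightarrow> s x \<ge> 0"
    and S_lim: "filterlim S at_top at_top"
    and \<Phi>: "\<And>x. b \<le> x \<Longrightarrow> (\<Phi> has_real_derivative norm (k x)) (at x)"
    and \<Phi>_init: "\<Phi> b = 0" and \<Phi>_le: "\<And>x. b \<le> x \<Longrightarrow> \<Phi> x \<le> 1 / 4"
  shows "\<exists>\<alpha>. \<alpha> \<noteq> 0 \<and> (A \<longlongrightarrow> \<alpha>) at_top \<and> (B \<longlongrightarrow> 0) at_top"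
proof -
  have S_mono: "S x \<le> S y" if "b \<le> x" "x \<le> y" for x y
    using norm_diff_le_if_vector_derivative_bounded[of x y "\<lambda>_. 0::real" "\<lambda>_. 0" S s] S s that by auto
  have \<Phi>_mono: "\<Phi> x \<le> \<Phi> y" if "b \<le> x" "x \<le> y" for x y
    using norm_diff_le_if_vector_derivative_bounded
      [of x y "\<lambda>_. 0::real" "\<lambda>_. 0" \<Phi> "\<lambda>x. norm (k x)"] \<Phi> that by auto
  obtain \<phi> where \<phi>: "(\<Phi> \<longlongrightarrow> \<phi>) at_top" "\<And>x. b \<le> x \<Longrightarrow> \<Phi> x \<le> \<phi>"
    using tendsto_at_top_if_increasing_bounded[of b \<Phi>] \<Phi>_mono \<Phi>_le by blast
  \<comment> \<open>The integrating factor removes the damping term from the equation for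
    \<open>B\<close>.\<close>
  define E where "E = (\<lambda>x. exp (2 * S x) *\<^sub>R B x)"
  have E: "(E has_vector_derivative - exp (2 * S x) *\<^sub>R (k x * (A x + B x))) (at x)" if "b \<le> x" for x
    unfolding E_def using B[OF that] S[OF that]
    by (auto intro!: derivative_eq_intros simp: algebra_simps)
  have A_step: "norm (A y - A x) \<le> N * (\<Phi> y - \<Phi> x)"
    and E_step: "norm (E y - E x) \<le> exp (2 * S y) * (N * (\<Phi> y - \<Phi> x))"
    if xy: "b \<le> x" "x \<le> y" and N: "\<And>t. x \<le> t \<Longrightarrow> t \<le> y \<Longrightarrow> norm (A t + B t) \<le> N" for x y N
  proof -
    have kAB: "norm (k t * (A t + B t)) \<le> N * norm (k t)" if "x \<le> t" "t \<le> y" for t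
      using mult_left_mono[OF N[OF that], of "norm (k t)"] by (simp add: norm_mult mult.commute)
    have "norm (A y - A x) \<le> N * \<Phi> y - N * \<Phi> x"
      using xy kAB
      by (intro norm_diff_le_if_vector_derivative_bounded[where F'="\<lambda>t. k t * (A t + B t)"
          and \<phi>'="\<lambda>t. N * norm (k t)"] A DERIV_cmult \<Phi>) auto
    then show "norm (A y - A x) \<le> N * (\<Phi> y - \<Phi> x)"
      by (simp add: right_diff_distrib)
    have "norm (E y - E x) \<le> exp (2 * S y) * N * \<Phi> y - exp (2 * S y) * N * \<Phi> x"
    proof (rule norm_diff_le_if_vector_derivative_bounded[OF xy(2)])
      fix t assume t: "x \<le> t" "t \<le> y"
      with xy have "b \<le> t" by simp
      then show "(E has_vector_derivative - exp (2 * S t) *\<^sub>R (k t * (A t + B t))) (at t)"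
        by (rule E)
      from \<open>b \<le> t\<close> show "((\<lambda>t. exp (2 * S y) * N * \<Phi> t) has_real_derivative
          exp (2 * S y) * N * norm (k t)) (at t)"
        by (intro DERIV_cmult \<Phi>)
      have "exp (2 * S t) * norm (k t * (A t + B t)) \<le> exp (2 * S y) * (N * norm (k t))"
        using S_mono[of t y] t xy by (intro mult_mono kAB) auto
      then show "norm (- exp (2 * S t) *\<^sub>R (k t * (A t + B t))) \<le> exp (2 * S y) * N * norm (k t)"
        by (simp add: mult.assoc)
    qed
    then show "norm (E y - E x) \<le> exp (2 * S y) * (N * (\<Phi> y - \<Phi> x))"
      by (simp add: algebra_simps)
  qed
  have B_le: "norm (B y) \<le> N * \<Phi> y"
    if "b \<le> y" "\<And>t. b \<le> t \<Longrightarrow> t \<le> y \<Longrightarrow> norm (A t + B t) \<le> N" for y N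
    using E_step[of b y N] that by (simp add: E_def init \<Phi>_init)
  have AB: "norm (A x + B x) \<le> 2" if "b \<le> x" for x
  proof -
    \<comment> \<open>At a point where the norm of \<open>A + B\<close> attains its maximum
      \<open>N\<close> on the interval, the step estimates from \<open>b\<close> give
      \<open>N \<le> 1 + N / 4 + N / 4\<close>, hence \<open>N \<le> 2\<close>.\<close>
    have "continuous_on {b..x} (\<lambda>t. norm (A t + B t))"
      by (intro continuous_intros continuous_at_imp_continuous_on ballI
          has_vector_derivative_continuous[OF A] has_vector_derivative_continuous[OF B]) auto
    then obtain t where t: "t \<in> {b..x}"
        "\<And>\<tau>. \<tau> \<in> {b..x} \<Longrightarrow> norm (A \<tau> + B \<tau>) \<le> norm (A t + B t)"
      using continuous_attains_sup[of "{b..x}" "\<lambda>t. norm (A t + B t)"] \<open>b \<le> x\<close> by auto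
    define N where "N = norm (A t + B t)"
    have "norm (A t - 1) \<le> N * \<Phi> t" "norm (B t) \<le> N * \<Phi> t"
      using A_step[of b t N] B_le[of t N] t by (auto simp: init \<Phi>_init N_def)
    moreover have "N * \<Phi> t \<le> N * (1 / 4)"
      using t \<Phi>_le by (intro mult_left_mono) (auto simp: N_def)
    moreover have "N \<le> norm (A t - 1) + norm (B t) + 1"
      using norm_triangle_ineq[of "A t - 1 + B t" 1] norm_triangle_ineq[of "A t - 1" "B t"]
      by (simp add: N_def algebra_simps)
    ultimately have "N \<le> 2" by simp
    with t(2)[of x] that show ?thesis by (simp add: N_def)
  qed
  have "((\<lambda>x. 2 * (\<phi> - \<Phi> x)) \<longlongrightarrow> 2 * (\<phi> - \<phi>)) at_top"
    by (intro tendsto_intros \<phi>)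
  then have \<theta>: "((\<lambda>x. 2 * (\<phi> - \<Phi> x)) \<longlongrightarrow> 0) at_top"
    by simp
  have "norm (A y - A x) \<le> 2 * (\<phi> - \<Phi> x)" if "b \<le> x" "x \<le> y" for x y
    using A_step[of x y 2] AB \<phi>(2)[of y] that by force
  then obtain \<alpha> where \<alpha>: "(A \<longlongrightarrow> \<alpha>) at_top"
    using tendsto_at_top_if_norm_diff_le[OF _ \<theta>, of b A] by blast
  have "norm (\<alpha> - 1) \<le> 1 / 2"
  proof (rule tendsto_upperbound)
    show "((\<lambda>x. norm (A x - 1)) \<longlongrightarrow> norm (\<alpha> - 1)) at_top"
      by (intro tendsto_intros \<alpha>)
    show "\<forall>\<^sub>F x in at_top. norm (A x - 1) \<le> 1 / 2"
      using eventually_ge_at_top[of b]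
    proof eventually_elim
      case (elim x)
      then show ?case
        using A_step[of b x 2] AB \<Phi>_le[of x] by (simp add: init \<Phi>_init)
    qed
  qed simp
  then have "\<alpha> \<noteq> 0" by auto
  moreover have "(B \<longlongrightarrow> 0) at_top"
  proof (rule tendstoI)
    fix e :: real assume "e > 0"
    then have "\<forall>\<^sub>F x in at_top. b \<le> x \<and> 2 * (\<phi> - \<Phi> x) < e / 2"
      by (intro eventually_conj eventually_ge_at_top order_tendstoD(2)[OF \<theta>]) simp
    then obtain X where X: "b \<le> X" "2 * (\<phi> - \<Phi> X) < e / 2"
      using eventually_happens' trivial_limit_at_top_linorder by blast
    \<comment> \<open>With \<open>X\<close> frozen, what \<open>B\<close> accumulated before
      \<open>X\<close> is damped away; what it gains after \<open>X\<close> is bounded by the tail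
      of \<open>\<Phi>\<close>, already below \<open>e / 2\<close>.\<close>
    have "((\<lambda>x. exp (- (2 * S x)) * norm (E X)) \<longlongrightarrow> 0 * norm (E X)) at_top"
      by (intro tendsto_intros filterlim_compose[OF exp_at_bot]
          filterlim_compose[OF filterlim_uminus_at_bot_at_top]
          filterlim_tendsto_pos_mult_at_top[OF tendsto_const] S_lim) simp
    then have "\<forall>\<^sub>F x in at_top. exp (- (2 * S x)) * norm (E X) < e / 2"
      using \<open>e > 0\<close> by (intro order_tendstoD(2)) auto
    with eventually_ge_at_top[of X] show "\<forall>\<^sub>F x in at_top. dist (B x) 0 < e"
    proof eventually_elim
      case (elim x)
      have "norm (E x) \<le> norm (E x - E X) + norm (E X)"
        using norm_triangle_ineq[of "E x - E X" "E X"] by simp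
      also have "norm (E x - E X) \<le> exp (2 * S x) * (2 * (\<Phi> x - \<Phi> X))"
        using elim X AB by (intro E_step) auto
      also have "\<dots> \<le> exp (2 * S x) * (2 * (\<phi> - \<Phi> X))"
        using \<phi>(2)[of x] elim X by simp
      finally have "exp (- (2 * S x)) * norm (E x)
          \<le> exp (- (2 * S x)) * (exp (2 * S x) * (2 * (\<phi> - \<Phi> X)) + norm (E X))"
        by (intro mult_left_mono) auto
      then have "norm (B x) \<le> 2 * (\<phi> - \<Phi> X) + exp (- (2 * S x)) * norm (E X)"
        by (simp add: E_def distrib_left flip: mult.assoc exp_add)
      with elim X show ?case by simp
    qed
  qed
  ultimately show ?thesis using \<alpha> by blast
qed

text \<open>The increments of any antiderivative of the norm of \<open>k\<close> are bounded by the
  integral over the half line, so it increases to a limit; \<open>b\<close> is a point where it is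
  within \<open>e\<close> of that limit.\<close>

lemma small_tail_antiderivative:
  fixes k :: "real \<Rightarrow> complex"
  assumes cont: "continuous_on {a<..} k" and int: "k absolutely_integrable_on {a<..}" and "e > 0"
  obtains b \<Phi> where "b > a" "\<Phi> b = 0"
    "\<And>x. a < x \<Longrightarrow> (\<Phi> has_real_derivative norm (k x)) (at x)"
    "\<And>x. b \<le> x \<Longrightarrow> \<Phi> x \<le> e"
proof -
  have norm_int: "(\<lambda>x. norm (k x)) integrable_on {a<..}"
    using int by (simp add: absolutely_integrable_on_def)
  obtain \<Phi> where \<Phi>: "\<And>x. a < x \<Longrightarrow> (\<Phi> has_real_derivative norm (k x)) (at x)"
    using antiderivative_vanishing_at[of a "\<lambda>x. norm (k x)"] cont
    by (auto simp: has_real_derivative_iff_has_vector_derivative continuous_on_norm)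
  have diff: "0 \<le> \<Phi> y - \<Phi> x \<and> \<Phi> y - \<Phi> x \<le> integral {a<..} (\<lambda>x. norm (k x))"
    if "a < x" "x \<le> y" for x y
  proof -
    have I: "((\<lambda>x. norm (k x)) has_integral (\<Phi> y - \<Phi> x)) {x..y}"
      using that \<Phi> by (intro fundamental_theorem_of_calculus)
        (auto simp: has_real_derivative_iff_has_vector_derivative intro: has_vector_derivative_at_within)
    then have "integral {x..y} (\<lambda>x. norm (k x)) \<le> integral {a<..} (\<lambda>x. norm (k x))"
      using that by (intro integral_subset_le norm_int) auto
    then show ?thesis
      using has_integral_nonneg[OF I] integral_unique[OF I] by simp
  qed
  have "\<exists>L. (\<Phi> \<longlongrightarrow> L) at_top \<and> (\<forall>x\<ge>a + 1. \<Phi> x \<le> L)"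
    using diff diff[of "a + 1"]
    by (intro tendsto_at_top_if_increasing_bounded
        [where M = "\<Phi> (a + 1) + integral {a<..} (\<lambda>x. norm (k x))"]) (force simp: algebra_simps)+
  then obtain L where L: "(\<Phi> \<longlongrightarrow> L) at_top" "\<And>x. x \<ge> a + 1 \<Longrightarrow> \<Phi> x \<le> L"
    by blast
  have "\<forall>\<^sub>F x in at_top. L - e < \<Phi> x"
    using L(1) \<open>e > 0\<close> by (intro order_tendstoD(1)) auto
  then have "\<forall>\<^sub>F x in at_top. a + 1 \<le> x \<and> L - e < \<Phi> x"
    using eventually_ge_at_top by (rule eventually_conj[rotated])
  then obtain b where b: "a + 1 \<le> b" "L - e < \<Phi> b"
    using eventually_happens' trivial_limit_at_top_linorder by blast
  show ?thesis
  proof (rule that[of b "\<lambda>x. \<Phi> x - \<Phi> b"])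
    show "((\<lambda>x. \<Phi> x - \<Phi> b) has_real_derivative norm (k x)) (at x)" if "a < x" for x
      using \<Phi>[OF that] by (auto intro!: derivative_eq_intros)
    show "\<Phi> x - \<Phi> b \<le> e" if "b \<le> x" for x
      using L(2)[of x] b that by simp
  qed (use b in auto)
qed

text \<open>An abstract weight \<open>w\<close> stands for the power -1/4 of \<open>f\<close>, and
  \<open>q\<close> for \<open>f + g\<close>. In that case
  \<open>f * w\<^sup>2 = 1 / w\<^sup>2\<close>, and the assumption on \<open>\<psi>\<close> says
  that \<open>\<psi>\<close> is the remaining error term. All pointwise assumptions concern the open
  half line, since \<open>w\<close> may be singular at \<open>a\<close>.\<close>

locale liouville_green =
  fixes a :: real and w w' w'' S :: "real \<Rightarrow> real" and q \<psi> :: "real \<Rightarrow> complex"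
  assumes w_pos: "\<And>x. a < x \<Longrightarrow> w x > 0"
    and w: "\<And>x. a < x \<Longrightarrow> (w has_real_derivative w' x) (at x)"
    and w': "\<And>x. a < x \<Longrightarrow> (w' has_real_derivative w'' x) (at x)"
    and S: "\<And>x. a < x \<Longrightarrow> (S has_real_derivative 1 / (w x)\<^sup>2) (at x)"
    and S_lim: "filterlim S at_top at_top"
    and q: "continuous_on {a<..} q"
    and \<psi>: "\<And>x. a < x \<Longrightarrow> w x * (q x * w x - w'' x) = 1 / (w x)\<^sup>2 + \<psi> x"
    and \<psi>_cont: "continuous_on {a<..} \<psi>"
    and \<psi>_int: "\<psi> absolutely_integrable_on {a<..}"
begin

text \<open>The derivative is carried as an argument because \<open>p\<close> refers to it.\<close>

definition solution where
  "solution u u' \<longleftrightarrow> (\<forall>x>a. (u has_vector_derivative u' x) (at x) \<and>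
     (u' has_vector_derivative q x * u x) (at x))"

definition v :: "(real \<Rightarrow> complex) \<Rightarrow> real \<Rightarrow> complex" where
  "v u x = u x / w x"

text \<open>The derivative of \<open>v u\<close> with respect to the Liouville variable \<open>S\<close>.\<close>
definition p :: "(real \<Rightarrow> complex) \<Rightarrow> (real \<Rightarrow> complex) \<Rightarrow> real \<Rightarrow> complex" where
  "p u u' x = of_real (w x) * u' x - of_real (w' x) * u x"

lemma solutionD:
  assumes "solution u u'" "a < x"
  shows "(u has_vector_derivative u' x) (at x)" "(u' has_vector_derivative q x * u x) (at x)"
  using assms by (auto simp: solution_def)

lemma solution_diff_cmult:
  assumes "solution u u'" "solution z z'"
  shows "solution (\<lambda>x. u x - c * z x) (\<lambda>x. u' x - c * z' x)"
  using assms unfolding solution_def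
  by (auto intro!: derivative_eq_intros simp: algebra_simps)

lemma solution_exists:
  assumes "a < b"
  obtains u u' where "solution u u'" "u b = c\<^sub>0" "u' b = c\<^sub>1"
  using linear_second_order_initial_value_problem[OF q assms, of c\<^sub>0 c\<^sub>1]
  unfolding solution_def by metis

text \<open>The numerator in the quotient rule is exactly \<open>p u u'\<close>.\<close>

lemma v_derivative:
  assumes "solution u u'" "a < x"
  shows "(v u has_vector_derivative p u u' x / (w x)\<^sup>2) (at x)"
proof -
  have "((\<lambda>x. of_real (w x)) has_vector_derivative complex_of_real (w' x)) (at x)"
    using w[OF assms(2)] has_vector_derivative_of_real has_real_derivative_iff_has_vector_derivative
    by blast
  then have "((\<lambda>x. u x / w x) has_vector_derivative (w x * u' x - u x * w' x) / (of_real (w x))\<^sup>2) (at x)"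
    using solutionD(1)[OF assms] w_pos[OF assms(2)]
    by (intro has_vector_derivative_divide_complex) auto
  then show ?thesis
    by (simp add: v_def[abs_def] p_def mult.commute)
qed

text \<open>The products \<open>w' * u'\<close> cancel, and the assumption on \<open>\<psi>\<close>
  identifies the coefficient that is left.\<close>

lemma p_derivative:
  assumes "solution u u'" "a < x"
  shows "(p u u' has_vector_derivative (1 / (w x)\<^sup>2 + \<psi> x) * v u x) (at x)"
proof -
  have "(p u u' has_vector_derivative w x * (q x * u x) - w'' x * u x) (at x)"
    unfolding p_def[abs_def]
    by (rule derivative_eq_intros w w' solutionD[OF assms] refl assms(2))+ simp
  moreover have "w x * (q x * u x) - w'' x * u x = w x * (q x * w x - w'' x) * v u x"
    using w_pos[OF assms(2)] by (simp add: v_def field_simps)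
  ultimately show ?thesis
    by (simp add: \<psi>[OF assms(2)])
qed

lemma dominant_solution:
  obtains u u' where "solution u u'"
    "((\<lambda>x. exp (- S x) * v u x) \<longlongrightarrow> 1) at_top" "((\<lambda>x. exp (- S x) * p u u' x) \<longlongrightarrow> 1) at_top"
proof -
  define k where "k = (\<lambda>x. \<psi> x / 2)"
  have "continuous_on {a<..} k" "k absolutely_integrable_on {a<..}"
    unfolding k_def using \<psi>_cont \<psi>_int by (auto intro!: continuous_intros set_integrable_divide)
  then obtain b \<Phi> where b: "a < b" and \<Phi>: "\<Phi> b = 0"
      "\<And>x. a < x \<Longrightarrow> (\<Phi> has_real_derivative norm (k x)) (at x)"
      "\<And>x. b \<le> x \<Longrightarrow> \<Phi> x \<le> 1 / 4"
    by (rule small_tail_antiderivative[where e="1 / 4"]) auto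
  \<comment> \<open>These initial values make \<open>v\<close> and \<open>p\<close> both equal to
    \<open>exp (S b)\<close>, which means \<open>A b = 1\<close> and \<open>B b = 0\<close>.\<close>
  obtain u u' where u: "solution u u'" "u b = w b * exp (S b)"
      "u' b = (1 + w' b * w b) * exp (S b) / w b"
    using solution_exists[OF b] by blast
  have vp_b: "v u b = exp (S b)" "p u u' b = exp (S b)"
    using w_pos[OF b] by (auto simp: v_def p_def u field_simps)
  define A B where "A = (\<lambda>x. (exp (- S x) / 2) *\<^sub>R (v u x + p u u' x))"
    and "B = (\<lambda>x. (exp (- S x) / 2) *\<^sub>R (v u x - p u u' x))"
  have AB: "A x + B x = exp (- S x) *\<^sub>R v u x" for x
    by (simp add: A_def B_def scaleR_conv_of_real field_simps)
  have "\<exists>\<alpha>. \<alpha> \<noteq> 0 \<and> (A \<longlongrightarrow> \<alpha>) at_top \<and> (B \<longlongrightarrow> 0) at_top"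
  proof (rule perturbed_diagonal_system_asymptotics)
    fix x assume "b \<le> x"
    with b have x: "a < x" by simp
    have vp: "((\<lambda>x. v u x + p u u' x) has_vector_derivative
        p u u' x / (w x)\<^sup>2 + (1 / (w x)\<^sup>2 + \<psi> x) * v u x) (at x)"
      "((\<lambda>x. v u x - p u u' x) has_vector_derivative
        p u u' x / (w x)\<^sup>2 - (1 / (w x)\<^sup>2 + \<psi> x) * v u x) (at x)"
      by (intro derivative_intros v_derivative p_derivative u x)+
    have e: "((\<lambda>x. exp (- S x) / 2) has_real_derivative - (1 / (w x)\<^sup>2) * exp (- S x) / 2) (at x)"
      using S[OF x] by (auto intro!: derivative_eq_intros)
    show "(A has_vector_derivative k x * (A x + B x)) (at x)"
      unfolding AB unfolding A_def
      by (rule has_vector_derivative_eq_rhs[OF has_vector_derivative_scaleR[OF e vp(1)]])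
        (use w_pos[OF x] in \<open>simp add: k_def scaleR_conv_of_real field_simps\<close>)
    show "(B has_vector_derivative - (2 * (1 / (w x)\<^sup>2)) *\<^sub>R B x - k x * (A x + B x)) (at x)"
      unfolding AB unfolding B_def
      by (rule has_vector_derivative_eq_rhs[OF has_vector_derivative_scaleR[OF e vp(2)]])
        (use w_pos[OF x] in \<open>simp add: k_def scaleR_conv_of_real divide_simps; simp add: algebra_simps\<close>)
    show "(S has_real_derivative 1 / (w x)\<^sup>2) (at x)"
      by (rule S[OF x])
    show "(\<Phi> has_real_derivative norm (k x)) (at x)" "\<Phi> x \<le> 1 / 4"
      using \<Phi> x \<open>b \<le> x\<close> by auto
  qed (use \<Phi> S_lim in \<open>auto simp: A_def B_def vp_b scaleR_conv_of_real exp_of_real exp_minus_inverse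
      simp flip: of_real_mult exp_add\<close>)
  then obtain \<alpha> where \<alpha>: "\<alpha> \<noteq> 0" "(A \<longlongrightarrow> \<alpha>) at_top" "(B \<longlongrightarrow> 0) at_top"
    by blast
  \<comment> \<open>Sum and difference recover \<open>v\<close> and \<open>p\<close>, each scaled by
    \<open>exp (- S)\<close>; dividing the solution by \<open>\<alpha>\<close> normalises both
    limits to 1.\<close>
  have "((\<lambda>x. (A x + B x) / \<alpha>) \<longlongrightarrow> (\<alpha> + 0) / \<alpha>) at_top" "((\<lambda>x. (A x - B x) / \<alpha>) \<longlongrightarrow> (\<alpha> - 0) / \<alpha>) at_top"
    by (intro tendsto_intros \<alpha>)+
  moreover have "(A x + B x) / \<alpha> = exp (- S x) * v (\<lambda>x. u x / \<alpha>) x"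
    "(A x - B x) / \<alpha> = exp (- S x) * p (\<lambda>x. u x / \<alpha>) (\<lambda>x. u' x / \<alpha>) x" for x
    using \<open>\<alpha> \<noteq> 0\<close> by (simp_all add: A_def B_def v_def p_def scaleR_conv_of_real field_simps)
  moreover have "solution (\<lambda>x. u x / \<alpha>) (\<lambda>x. u' x / \<alpha>)"
    using u(1) unfolding solution_def by (auto intro!: derivative_eq_intros)
  ultimately show ?thesis
    using that \<open>\<alpha> \<noteq> 0\<close> by simp
qed

lemma recessive_solution:
  obtains u u' where "solution u u'"
    "((\<lambda>x. exp (S x) * v u x) \<longlongrightarrow> 1) at_top" "((\<lambda>x. exp (S x) * p u u' x) \<longlongrightarrow> - 1) at_top"
proof -
  obtain u u' where u: "solution u u'" and v_lim: "((\<lambda>x. exp (- S x) * v u x) \<longlongrightarrow> 1) at_top"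
    and p_lim: "((\<lambda>x. exp (- S x) * p u u' x) \<longlongrightarrow> 1) at_top"
    by (rule dominant_solution)
  have "\<forall>\<^sub>F x in at_top. a < x \<and> exp (- S x) * v u x \<noteq> 0"
    by (intro eventually_conj eventually_gt_at_top tendsto_imp_eventually_ne[OF v_lim]) simp
  then obtain b where b: "\<And>x. b \<le> x \<Longrightarrow> a < x" "\<And>x. b \<le> x \<Longrightarrow> u x \<noteq> 0"
    by (auto simp: eventually_at_top_linorder v_def)
  \<comment> \<open>The Wronskian -2 is chosen so that the derivative of \<open>z / u\<close>,
    namely \<open>- 2 / u\<^sup>2\<close>, matches the derivative of \<open>exp (- 2 S)\<close>
    without a further constant.\<close>
  obtain z z' where z: "solution z z'" "z b = 0" "z' b = - 2 / u b"
    using solution_exists[OF b(1)[OF order_refl]] by blast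
  have W: "u x * z' x - z x * u' x = - 2" if "a < x" for x
    using wronskian_constant[OF solutionD[OF u] solutionD[OF z(1)] that b(1)[OF order_refl]]
      b(2)[of b] by (simp add: z)
  define \<theta> where "\<theta> = (\<lambda>x. exp (- 2 * S x))"
  define \<theta>' where "\<theta>' = (\<lambda>x. - 2 / (w x)\<^sup>2 * exp (- 2 * S x))"
  \<comment> \<open>Since \<open>u = w * v u\<close>, this is the quotient of the derivatives of
    \<open>z / u\<close> and \<open>\<theta>\<close>; it tends to 1 by the normalisation of
    \<open>u\<close>.\<close>
  define r where "r = (\<lambda>x. 1 / (exp (- S x) * v u x)\<^sup>2)"
  have "\<exists>L. ((\<lambda>x. (z x / u x - L) /\<^sub>R \<theta> x) \<longlongrightarrow> 1) at_top"
  proof (rule lhopital_at_top_vector)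
    fix x assume "b \<le> x"
    note x = b[OF this] w_pos[OF b(1)[OF this]]
    have "((\<lambda>x. z x / u x) has_vector_derivative (u x * z' x - z x * u' x) / (u x)\<^sup>2) (at x)"
      by (intro has_vector_derivative_divide_complex solutionD[OF u] solutionD[OF z(1)] x)
    moreover have "exp (- 2 * S x) = exp (- S x) * exp (- S x)"
      by (simp flip: exp_add)
    then have "\<theta>' x *\<^sub>R r x = (u x * z' x - z x * u' x) / (u x)\<^sup>2"
      unfolding W[OF x(1)] using x by (simp add: \<theta>'_def r_def v_def scaleR_conv_of_real power2_eq_square field_simps)
    ultimately show "((\<lambda>x. z x / u x) has_vector_derivative \<theta>' x *\<^sub>R r x) (at x)"
      by simp
    show "(\<theta> has_real_derivative \<theta>' x) (at x)"
      unfolding \<theta>_def \<theta>'_def using S[OF x(1)] by (auto intro!: derivative_eq_intros)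
    show "\<theta>' x \<le> 0" "\<theta> x > 0"
      by (auto simp: \<theta>_def \<theta>'_def)
  next
    have "filterlim (\<lambda>x. 2 * S x) at_top at_top"
      by (intro filterlim_tendsto_pos_mult_at_top[OF tendsto_const] S_lim) simp
    then show "(\<theta> \<longlongrightarrow> 0) at_top"
      unfolding \<theta>_def using filterlim_compose[OF exp_at_bot filterlim_compose[OF filterlim_uminus_at_bot_at_top]]
      by simp
    have "(r \<longlongrightarrow> 1 / 1\<^sup>2) at_top"
      unfolding r_def by (intro tendsto_intros v_lim) simp
    then show "(r \<longlongrightarrow> 1) at_top" by simp
  qed
  then obtain L where L: "((\<lambda>x. (z x / u x - L) /\<^sub>R \<theta> x) \<longlongrightarrow> 1) at_top" ..
  define y y' where "y = (\<lambda>x. z x - L * u x)" and "y' = (\<lambda>x. z' x - L * u' x)"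
  have y: "solution y y'"
    unfolding y_def y'_def by (rule solution_diff_cmult[OF z(1) u])
  have ev: "\<forall>\<^sub>F x in at_top. b \<le> x"
    by (rule eventually_ge_at_top)
  have "((\<lambda>x. ((z x / u x - L) /\<^sub>R \<theta> x) * (exp (- S x) * v u x)) \<longlongrightarrow> 1 * 1) at_top"
    by (intro tendsto_intros L v_lim)
  moreover have "\<forall>\<^sub>F x in at_top. ((z x / u x - L) /\<^sub>R \<theta> x) * (exp (- S x) * v u x) = exp (S x) * v y x"
    using ev
  proof eventually_elim
    case (elim x)
    have "exp (- S x) / \<theta> x = exp (S x)"
      by (simp add: \<theta>_def flip: exp_diff)
    then have "exp (S x) * v y x = (exp (- S x) / \<theta> x) * v y x"
      by simp
    also have "\<dots> = ((z x / u x - L) /\<^sub>R \<theta> x) * (exp (- S x) * v u x)"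
      using b(2)[OF elim] w_pos[OF b(1)[OF elim]]
      by (simp add: v_def y_def \<theta>_def scaleR_conv_of_real field_simps)
    finally show ?case ..
  qed
  ultimately have vy: "((\<lambda>x. exp (S x) * v y x) \<longlongrightarrow> 1) at_top"
    by (simp cong: filterlim_cong add: tendsto_cong)
  \<comment> \<open>The limit of \<open>p y y'\<close> needs no second application of l'Hopital's
    rule: in terms of \<open>v\<close> and \<open>p\<close> the Wronskian of \<open>u\<close> and
    \<open>y\<close> is \<open>v u * p y y' - v y * p u u' = - 2\<close>, which is solved for
    \<open>p y y'\<close>.\<close>
  have "((\<lambda>x. (- 2 + (exp (S x) * v y x) * (exp (- S x) * p u u' x)) / (exp (- S x) * v u x))
      \<longlongrightarrow> (- 2 + 1 * 1) / 1) at_top"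
    by (intro tendsto_intros vy p_lim v_lim) simp
  moreover have "\<forall>\<^sub>F x in at_top.
      (- 2 + (exp (S x) * v y x) * (exp (- S x) * p u u' x)) / (exp (- S x) * v u x) = exp (S x) * p y y' x"
    using ev
  proof eventually_elim
    case (elim x)
    have "u x * y' x - y x * u' x = - 2"
      using W[OF b(1)[OF elim]] by (simp add: y_def y'_def algebra_simps)
    moreover have "v u x * p y y' x = (u x * y' x - y x * u' x) + v y x * p u u' x"
      using w_pos[OF b(1)[OF elim]] by (simp add: v_def p_def field_simps)
    ultimately have "v u x * p y y' x = - 2 + v y x * p u u' x"
      by simp
    moreover have v_u: "v u x \<noteq> 0"
      using b[OF elim] w_pos[OF b(1)[OF elim]] by (auto simp: v_def)
    ultimately have p_y: "p y y' x = (- 2 + v y x * p u u' x) / v u x"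
      by (simp add: field_simps)
    show ?case
      unfolding p_y using v_u by (simp add: exp_minus field_simps)
  qed
  ultimately have "((\<lambda>x. exp (S x) * p y y' x) \<longlongrightarrow> - 1) at_top"
    by (simp add: tendsto_cong)
  with that y vy show ?thesis by blast
qed

end

theorem proposition3p1:
  fixes a :: real and f :: "real \<Rightarrow> real" and g :: "real \<Rightarrow> complex"
  assumes "a > 0"
    and "C2_on {a..} f"
    and "\<forall>x\<in>{a<..}. f x > 0"
    and "\<not> (\<lambda>x. \<bar>f x\<bar> powr (1/2)) absolutely_integrable_on {a<..}"
    and "continuous_on {a<..} g"
    and "psi f g absolutely_integrable_on {a<..}"
  shows "\<exists>u\<^sub>1 u\<^sub>2 :: real \<Rightarrow> complex.
    is_solution_on {a<..} (\<lambda>x. complex_of_real (f x) + g x) u\<^sub>1 \<and>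
    is_solution_on {a<..} (\<lambda>x. complex_of_real (f x) + g x) u\<^sub>2 \<and>
    (let S = (\<lambda>x. integral {a..x} (\<lambda>r. \<bar>f r\<bar> powr (1/2)));
         v\<^sub>1 = (\<lambda>x. complex_of_real (\<bar>f x\<bar> powr (1/4)) * u\<^sub>1 x);
         v\<^sub>2 = (\<lambda>x. complex_of_real (\<bar>f x\<bar> powr (1/4)) * u\<^sub>2 x)
     in ((\<lambda>x. complex_of_real (exp (- S x)) * v\<^sub>1 x) \<longlongrightarrow> 1) at_top \<and>
        ((\<lambda>x. complex_of_real (\<bar>f x\<bar> powr (-1/2) * exp (- S x)) * vector_derivative v\<^sub>1 (at x))
           \<longlongrightarrow> 1) at_top \<and>
        ((\<lambda>x. complex_of_real (exp (S x)) * v\<^sub>2 x) \<longlongrightarrow> 1) at_top \<and>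
        ((\<lambda>x. complex_of_real (\<bar>f x\<bar> powr (-1/2) * exp (S x)) * vector_derivative v\<^sub>2 (at x))
           \<longlongrightarrow> -1) at_top)"
proof -
  have f_pos: "f x > 0" if "a < x" for x
    using assms(3) that by simp
  obtain f' f'' where C2: "C2_derivatives_on {a..} f f' f''"
    using assms(2) by (auto simp: C2_on_def)
  have f: "(f has_real_derivative f' x) (at x)" "(f' has_real_derivative f'' x) (at x)"
    if "a < x" for x
  proof -
    \<comment> \<open>Away from the endpoint the one-sided derivatives in \<open>C2_on\<close> are
      ordinary ones.\<close>
    have "at x within {a..} = at x"
      using that by (intro at_within_interior) auto
    moreover have "x \<in> {a..}"
      using that by simp
    ultimately show "(f has_real_derivative f' x) (at x)" "(f' has_real_derivative f'' x) (at x)"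
      using C2 unfolding C2_derivatives_on_def has_real_derivative_iff_has_vector_derivative
      by metis+
  qed
  have f_cont: "continuous_on {a..} f"
    using C2 has_vector_derivative_continuous
    by (fastforce simp: C2_derivatives_on_def continuous_on_eq_continuous_within)
  have cont': "continuous_on {a<..} f" "continuous_on {a<..} f'"
    using f by (auto intro!: continuous_at_imp_continuous_on intro: DERIV_isCont)
  have f''_cont: "continuous_on {a<..} f''"
    using C2 by (auto simp: C2_derivatives_on_def elim: continuous_on_subset)

  \<comment> \<open>The weight, its derivatives and its powers\<close>
  define w where "w = (\<lambda>x. \<bar>f x\<bar> powr (-1/4))"
  define w' where "w' = (\<lambda>x. - 1/4 * f x powr (-5/4) * f' x)"
  define w'' where "w'' = (\<lambda>x. 5/16 * f x powr (-9/4) * (f' x)\<^sup>2 - 1/4 * f x powr (-5/4) * f'' x)"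
  define S where "S = (\<lambda>x. integral {a..x} (\<lambda>r. \<bar>f r\<bar> powr (1/2)))"
  have w: "(w has_real_derivative w' x) (at x)" if "a < x" for x
  proof -
    have "((\<lambda>x. f x powr (-1/4)) has_real_derivative w' x) (at x)"
      using f(1)[OF that] f_pos[OF that] by (auto intro!: derivative_eq_intros simp: w'_def)
    then show ?thesis
      by (rule has_field_derivative_transform_within_open[of _ _ _ "{a<..}"])
        (use that in \<open>auto simp: w_def abs_of_pos[OF f_pos]\<close>)
  qed
  have w': "(w' has_real_derivative w'' x) (at x)" if "a < x" for x
    unfolding w'_def w''_def using f[OF that] f_pos[OF that]
    by (auto intro!: derivative_eq_intros simp: power2_eq_square field_simps)
  have deriv_w: "deriv w x = w' x" if "a < x" for x
    using w[OF that] by (rule DERIV_imp_deriv)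
  have "deriv (deriv w) x = w'' x" if "a < x" for x
  \<comment> \<open>\<open>deriv w\<close> is known to equal \<open>w'\<close> only on the half
    line; its openness suffices to differentiate once more.\<close>
  proof (rule DERIV_imp_deriv)
    show "(deriv w has_real_derivative w'' x) (at x)"
      by (rule has_field_derivative_transform_within_open[OF w'[OF that], of "{a<..}"])
        (use that deriv_w in auto)
  qed
  then have psi_eq: "psi f g x = of_real (w x) * (- of_real (w'' x) + g x * of_real (w x))" if "a < x" for x
    using that by (simp add: psi_def w_def)
  have w_pos: "w x > 0" if "a < x" for x
    using f_pos[OF that] by (simp add: w_def)
  \<comment> \<open>True also at zeros of \<open>f\<close>, where both sides are 0 by the
    conventions for \<open>powr\<close> and division. This lets \<open>v_eq\<close> be an equality
    of functions.\<close>
  have inv_w: "\<bar>f x\<bar> powr (1/4) = 1 / w x" for x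
    by (simp add: w_def powr_minus_divide)
  have w2: "\<bar>f x\<bar> powr (-1/2) = (w x)\<^sup>2" for x
    by (simp add: w_def power2_eq_square flip: powr_add)
  have inv_w2: "\<bar>f x\<bar> powr (1/2) = 1 / (w x)\<^sup>2" for x
    by (simp add: powr_minus_divide flip: w2)
  have fw2: "f x * (w x)\<^sup>2 = 1 / (w x)\<^sup>2" if "a < x" for x
    using f_pos[OF that] powr_add[of "f x" 1 "- 1/2"] inv_w2[of x] w2[of x] by simp
  \<comment> \<open>\<open>f\<close> may vanish at \<open>a\<close>; written as a square root, the
    integrand is visibly continuous there too.\<close>
  have s_cont: "continuous_on {a..} (\<lambda>r. \<bar>f r\<bar> powr (1/2))"
    unfolding powr_half_sqrt[OF abs_ge_zero] using f_cont by (intro continuous_intros)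
  have q_cont: "continuous_on {a<..} (\<lambda>x. complex_of_real (f x) + g x)"
    using cont'(1) assms(5) by (intro continuous_intros)

  \<comment> \<open>Verification of the assumptions on the weight\<close>
  interpret liouville_green a w w' w'' S "\<lambda>x. complex_of_real (f x) + g x" "psi f g"
  proof
    show "filterlim S at_top at_top"
      unfolding S_def using s_cont assms(4)
      by (intro filterlim_integral_at_top_if_not_absolutely_integrable) auto
    have "continuous_on {a<..} w" "continuous_on {a<..} w''"
      unfolding w_def w''_def using cont' f''_cont less_imp_neq[OF f_pos]
      by (auto intro!: continuous_intros)
    then have "continuous_on {a<..} (\<lambda>x. of_real (w x) * (- of_real (w'' x) + g x * of_real (w x)))"
      using assms(5) by (intro continuous_intros)
    then show "continuous_on {a<..} (psi f g)"
      by (rule continuous_on_eq) (simp add: psi_eq)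
    fix x assume x: "a < x"
    show "(S has_real_derivative 1 / (w x)\<^sup>2) (at x)"
    proof -
      have "(S has_real_derivative 1 / (w x)\<^sup>2) (at x within {a..x + 1})"
        unfolding S_def inv_w2[symmetric] using x
        by (intro integral_has_real_derivative continuous_on_subset[OF s_cont]) auto
      moreover have "at x within {a..x + 1} = at x"
        using x by (intro at_within_interior) auto
      ultimately show ?thesis by simp
    qed
    have "of_real (w x) * ((of_real (f x) + g x) * of_real (w x) - of_real (w'' x))
        = of_real (f x * (w x)\<^sup>2) + psi f g x"
      by (simp add: psi_eq[OF x] power2_eq_square algebra_simps)
    then show "of_real (w x) * ((of_real (f x) + g x) * of_real (w x) - of_real (w'' x))
        = of_real (1 / (w x)\<^sup>2) + psi f g x"
      by (simp add: fw2[OF x])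
  qed (use w w' w_pos q_cont assms(6) in auto)

  \<comment> \<open>Return to the original equation\<close>
  have is_solution: "is_solution_on {a<..} (\<lambda>x. complex_of_real (f x) + g x) u"
    if "solution u u'" for u u'
  proof -
    have "continuous_on {a<..} u"
      by (intro continuous_at_imp_continuous_on ballI
          has_vector_derivative_continuous[OF solutionD(1)[OF that]]) auto
    then have "continuous_on {a<..} (\<lambda>x. (of_real (f x) + g x) * u x)"
      by (intro continuous_intros q_cont)
    then show ?thesis
      unfolding is_solution_on_def C2_derivatives_on_def using solutionD[OF that]
      by (intro exI[of _ u'] exI[of _ "\<lambda>x. (of_real (f x) + g x) * u x"])
        (auto intro: has_vector_derivative_at_within)
  qed
  have v_eq: "(\<lambda>x. complex_of_real (\<bar>f x\<bar> powr (1/4)) * u x) = v u" for u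
    by (simp add: fun_eq_iff v_def inv_w)
  \<comment> \<open>The factor \<open>\<bar>f x\<bar> powr (-1/2)\<close> is
    \<open>(w x)\<^sup>2\<close>, which turns the derivative of \<open>v u\<close> into
    \<open>p u u'\<close>. \<open>E\<close> covers both signs of the exponent.\<close>
  have p_tendsto: "((\<lambda>x. of_real (\<bar>f x\<bar> powr (-1/2) * E x) * vector_derivative (v u) (at x)) \<longlongrightarrow> l) at_top"
    if "solution u u'" "((\<lambda>x. of_real (E x) * p u u' x) \<longlongrightarrow> l) at_top" for u u' l and E :: "real \<Rightarrow> real"
    using that(2)
  proof (rule Lim_transform_eventually)
    show "\<forall>\<^sub>F x in at_top. of_real (E x) * p u u' x
        = of_real (\<bar>f x\<bar> powr (-1/2) * E x) * vector_derivative (v u) (at x)"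
      using eventually_gt_at_top[of a]
    proof eventually_elim
      case (elim x)
      then show ?case
        using vector_derivative_at[OF v_derivative[OF that(1) elim]] w_pos[OF elim] w2[of x]
        by simp
    qed
  qed
  obtain u\<^sub>1 u\<^sub>1' where u\<^sub>1: "solution u\<^sub>1 u\<^sub>1'" "((\<lambda>x. exp (- S x) * v u\<^sub>1 x) \<longlongrightarrow> 1) at_top"
    "((\<lambda>x. exp (- S x) * p u\<^sub>1 u\<^sub>1' x) \<longlongrightarrow> 1) at_top"
    by (rule dominant_solution)
  obtain u\<^sub>2 u\<^sub>2' where u\<^sub>2: "solution u\<^sub>2 u\<^sub>2'" "((\<lambda>x. exp (S x) * v u\<^sub>2 x) \<longlongrightarrow> 1) at_top"
    "((\<lambda>x. exp (S x) * p u\<^sub>2 u\<^sub>2' x) \<longlongrightarrow> - 1) at_top"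
    by (rule recessive_solution)
  show ?thesis
    unfolding Let_def v_eq
    using is_solution[OF u\<^sub>1(1)] is_solution[OF u\<^sub>2(1)] u\<^sub>1(2) u\<^sub>2(2)
      p_tendsto[OF u\<^sub>1(1,3)] p_tendsto[OF u\<^sub>2(1,3)]
    by (intro exI[of _ u\<^sub>1] exI[of _ u\<^sub>2] conjI) (simp_all add: S_def)
qed

end
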